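(* Let $H$ be a finite group and $G$ a finitely generated residually finite group. Let $\bar w$ be a finite system of equations belonging to $Sys(Fin)$. Then $\bar w$ is solvable over the wreath product $H\wr G$.
   Context: Let $\bar y=(y_1,y_2,\dots)$ (constants) and $\bar x=(x_1,x_2,\dots)$ (variables) be countable sets of symbols and $F=F(\bar y,\bar x)$ the free group on them. A system of equations is a tuple $\bar w\in F^r(y_1,\dots,y_k,x_1,\dots,x_n)$ for some $k,n,r$; by substitution it defines a map $G^k\times G^n\to G^r$ for any group $G$, and $\bar w=1$ means all $r$ coordinates equal $1$. The system $\bar w$ is solvable in a group $G$ if for every $\bar a\in G^k$ there is $\bar x\in G^n$ with $\bar w(\bar a,\bar x)=1$. It is solvable over a group $G$ if there is a group $L\ge G$ such that for every $\bar a\in G^k$ there is $\bar x\in L^n$ with $\bar w(\bar a,\bar x)=1$. $Sys(Fin)$ denotes the set of finite systems of equations that are solvable in every finite group. The wreath product $H\wr G$ is the semidirect product $H^G\rtimes G$ (with $H^G$ all functions $G\to H$, pointwise multiplication), with action $(g.f)(x)=f(xg)$ and multiplication $(f,g)(f',g')=(f\,(g.f'),gg')$. *)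

theory Defs
  imports "HOL-Algebra.Algebra" "HOL-Library.FuncSet"
begin

text \<open>Letters of the free group F(y,x): (Inl i, b) is the constant y_i, (Inr j, b) the
  variable x_j; b = True means the inverse letter. A word is a list of letters.
  Indices are 0-based.\<close>
type_synonym letter = "(nat + nat) \<times> bool"
type_synonym word = "letter list"

definition eval_letter :: "('a, 'b) monoid_scheme \<Rightarrow> (nat \<Rightarrow> 'a) \<Rightarrow> (nat \<Rightarrow> 'a) \<Rightarrow> letter \<Rightarrow> 'a" where
  "eval_letter G a x l =
     (let g = (case fst l of Inl i \<Rightarrow> a i | Inr j \<Rightarrow> x j)
      in if snd l then inv\<^bsub>G\<^esub> g else g)"

definition eval_word :: "('a, 'b) monoid_scheme \<Rightarrow> (nat \<Rightarrow> 'a) \<Rightarrow> (nat \<Rightarrow> 'a) \<Rightarrow> word \<Rightarrow> 'a" where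
  "eval_word G a x w = foldr (\<lambda>l acc. eval_letter G a x l \<otimes>\<^bsub>G\<^esub> acc) w \<one>\<^bsub>G\<^esub>"

definition wf_system :: "nat \<Rightarrow> nat \<Rightarrow> word list \<Rightarrow> bool" where
  "wf_system k n ws \<longleftrightarrow>
     (\<forall>w\<in>set ws. \<forall>l\<in>set w. case fst l of Inl i \<Rightarrow> i < k | Inr j \<Rightarrow> j < n)"

definition solvable_in :: "('a, 'b) monoid_scheme \<Rightarrow> nat \<Rightarrow> nat \<Rightarrow> word list \<Rightarrow> bool" where
  "solvable_in G k n ws \<longleftrightarrow>
     (\<forall>a \<in> {..<k} \<rightarrow> carrier G. \<exists>x \<in> {..<n} \<rightarrow> carrier G.
        \<forall>w\<in>set ws. eval_word G a x w = \<one>\<^bsub>G\<^esub>)"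

text \<open>Sys(Fin). Every finite group is isomorphic to one with carrier a set of naturals,
  so quantifying over finite groups on type nat is quantifying over all finite groups.\<close>
definition SysFin :: "nat \<Rightarrow> nat \<Rightarrow> word list \<Rightarrow> bool" where
  "SysFin k n ws \<longleftrightarrow> wf_system k n ws \<and>
     (\<forall>G :: nat monoid. group G \<and> finite (carrier G) \<longrightarrow> solvable_in G k n ws)"

definition solvable_over :: "('a, 'b) monoid_scheme \<Rightarrow> nat \<Rightarrow> nat \<Rightarrow> word list \<Rightarrow> bool" where
  "solvable_over G k n ws \<longleftrightarrow>
     (\<exists>(L :: 'a set monoid) \<phi>. group L \<and> \<phi> \<in> hom G L \<and> inj_on \<phi> (carrier G) \<and>
        (\<forall>a \<in> {..<k} \<rightarrow> carrier G. \<exists>x \<in> {..<n} \<rightarrow> carrier L.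
           \<forall>w\<in>set ws. eval_word L (\<phi> \<circ> a) x w = \<one>\<^bsub>L\<^esub>))"

text \<open>Wreath product H wr G = H^G \<rtimes> G, (f,g)(f',g') = (f (g.f'), gg'), (g.f)(x) = f(xg).\<close>
definition wreath :: "('h, 'c) monoid_scheme \<Rightarrow> ('g, 'd) monoid_scheme \<Rightarrow> (('g \<Rightarrow> 'h) \<times> 'g) monoid" where
  "wreath H G =
     \<lparr> carrier = (carrier G \<rightarrow>\<^sub>E carrier H) \<times> carrier G,
       monoid.mult = (\<lambda>(f, g) (f', g'). (\<lambda>x\<in>carrier G. f x \<otimes>\<^bsub>H\<^esub> f' (x \<otimes>\<^bsub>G\<^esub> g), g \<otimes>\<^bsub>G\<^esub> g')),
       one = (\<lambda>x\<in>carrier G. \<one>\<^bsub>H\<^esub>, \<one>\<^bsub>G\<^esub>) \<rparr>"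

definition finitely_generated :: "('a, 'b) monoid_scheme \<Rightarrow> bool" where
  "finitely_generated G \<longleftrightarrow> (\<exists>S. finite S \<and> S \<subseteq> carrier G \<and> generate G S = carrier G)"

definition residually_finite :: "('a, 'b) monoid_scheme \<Rightarrow> bool" where
  "residually_finite G \<longleftrightarrow>
     (\<forall>g\<in>carrier G. g \<noteq> \<one>\<^bsub>G\<^esub> \<longrightarrow>
        (\<exists>N. N \<lhd> G \<and> finite (rcosets\<^bsub>G\<^esub> N) \<and> g \<notin> N))"

end

theory Submission
  imports Defs
begin

text \<open>Let Q be a finite quotient of G that is injective on a large finite set D. Transporting
  the values on D of a function from G to H to the image of D, and putting 1 elsewhere, gives a map from
  the wreath product of H and G to that of H and Q. It is multiplicative except at the points of Q
  on the boundary of the image of D, which may be most of it. So take many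
  nested sets D with pairwise disjoint boundaries, and solve the system for all of
  them simultaneously, in the finite wreath product of a power of H and Q. The Q-components of the solutions
  then do not depend on D, so a given finite set of words produces a finite set of points of Q that is
  independent of D, and by the pigeonhole principle some D has a boundary avoiding it. The group L
  consists of the words in the constants and the solution variables, where two words are
  identified if their values in these finite groups eventually agree, along the finite sets of words, at the
  points of Q produced by each word.\<close>

section \<open>Words over arbitrary alphabets and finite groups of arbitrary type\<close>

text \<open>One assignment on an arbitrary letter type, so that the same evaluation serves the
  equations and the words that make up the overgroup.\<close>

definition word_value :: "('a, 'b) monoid_scheme \<Rightarrow> ('l \<Rightarrow> 'a) \<Rightarrow> ('l \<times> bool) list \<Rightarrow> 'a" where
  "word_value G e w =
     foldr (\<lambda>l acc. (if snd l then inv\<^bsub>G\<^esub> (e (fst l)) else e (fst l)) \<otimes>\<^bsub>G\<^esub> acc) w \<one>\<^bsub>G\<^esub>"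

lemma word_value_Nil [simp]: "word_value G e [] = \<one>\<^bsub>G\<^esub>"
  by (simp add: word_value_def)

lemma word_value_Cons [simp]:
  "word_value G e (l # w) =
     (if snd l then inv\<^bsub>G\<^esub> (e (fst l)) else e (fst l)) \<otimes>\<^bsub>G\<^esub> word_value G e w"
  by (simp add: word_value_def)

lemma eval_word_eq_word_value: "eval_word G a x w = word_value G (case_sum a x) w"
  unfolding eval_word_def word_value_def eval_letter_def
  by (intro arg_cong[of _ _ "\<lambda>f. foldr f w \<one>\<^bsub>G\<^esub>"]) (auto simp: fun_eq_iff Let_def split: sum.splits)

lemma word_value_cong:
  "(\<And>l. l \<in> set w \<Longrightarrow> e (fst l) = e' (fst l)) \<Longrightarrow> word_value G e w = word_value G e' w"
  by (induction w) auto

lemma word_value_map: "word_value G e (map (map_prod \<sigma> id) w) = word_value G (e \<circ> \<sigma>) w"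
  by (induction w) auto

lemma (in group) word_value_closed:
  "(\<And>l. l \<in> set w \<Longrightarrow> e (fst l) \<in> carrier G) \<Longrightarrow> word_value G e w \<in> carrier G"
  by (induction w) auto

lemma (in group) word_value_append:
  assumes "\<And>l. e l \<in> carrier G"
  shows "word_value G e (u @ v) = word_value G e u \<otimes> word_value G e v"
  using assms by (induction u) (auto simp: m_assoc word_value_closed)

definition inverse_word :: "('l \<times> bool) list \<Rightarrow> ('l \<times> bool) list" where
  "inverse_word w = rev (map (apsnd Not) w)"

lemma (in group) word_value_inverse_word:
  assumes "\<And>l. e l \<in> carrier G"
  shows "word_value G e (inverse_word w) = inv (word_value G e w)"
proof (induction w)
  case (Cons l w)
  then show ?case
    using assms
    by (cases "snd l") (auto simp: inverse_word_def word_value_append inv_mult_group word_value_closed)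
qed (simp add: inverse_word_def)

lemma word_value_hom:
  assumes "group G" "group K" "h \<in> hom G K"
    and "\<And>l. l \<in> set w \<Longrightarrow> e (fst l) \<in> carrier G"
  shows "word_value K (h \<circ> e) w = h (word_value G e w)"
proof -
  interpret group_hom G K h
    using assms(1-3) by (simp add: group_hom_def group_hom_axioms_def)
  show ?thesis
    using assms(4) by (induction w) (auto simp: G.word_value_closed)
qed

lemma wf_system_letter:
  assumes "wf_system k n ws" "w \<in> set ws" "l \<in> set w"
    and "\<And>i. i < k \<Longrightarrow> P (Inl i)" "\<And>j. j < n \<Longrightarrow> P (Inr j)"
  shows "P (fst l)"
  using assms unfolding wf_system_def by (cases "fst l") fastforce+

text \<open>An injection copies the finite group into \<open>nat\<close>, where
  \<open>SysFin\<close> applies; the solution found there is pulled back.\<close>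

lemma SysFin_finite_group:
  fixes G :: "('a, 'b) monoid_scheme" (structure)
  assumes "SysFin k n ws" "group G" "finite (carrier G)"
  shows "solvable_in G k n ws"
proof -
  interpret group G by fact
  obtain f :: "'a \<Rightarrow> nat" where f: "inj_on f (carrier G)"
    using finite_imp_inj_to_nat_seg[OF assms(3)] by blast
  define K where "K = image_group f G"
  have grp: "group K" and hom: "f \<in> hom G K"
    using inj_imp_image_group_is_group[OF f] inj_imp_image_group_iso[OF f]
    by (auto simp: K_def iso_def)
  have carr: "carrier K = f ` carrier G" and one: "\<one>\<^bsub>K\<^esub> = f \<one>"
    by (simp_all add: K_def image_group_def)
  have wf: "wf_system k n ws" and "solvable_in K k n ws"
    using assms grp carr by (auto simp: SysFin_def)
  show ?thesis
    unfolding solvable_in_def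
  proof
    fix a assume a: "a \<in> {..<k} \<rightarrow> carrier G"
    then have "f \<circ> a \<in> {..<k} \<rightarrow> carrier K"
      by (auto simp: carr)
    with \<open>solvable_in K k n ws\<close> obtain x where x: "x \<in> {..<n} \<rightarrow> carrier K"
      and sol: "\<And>w. w \<in> set ws \<Longrightarrow> eval_word K (f \<circ> a) x w = \<one>\<^bsub>K\<^esub>"
      unfolding solvable_in_def by blast
    define y where "y = inv_into (carrier G) f \<circ> x"
    have y: "y j \<in> carrier G" "f (y j) = x j" if "j < n" for j
      using x that unfolding y_def carr
      by (auto simp: inv_into_into f_inv_into_f Pi_iff)
    have "eval_word G a y w = \<one>" if w: "w \<in> set ws" for w
    proof -
      have mem: "case_sum a y (fst l) \<in> carrier G" if "l \<in> set w" for l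
        by (rule wf_system_letter[OF wf w that]) (use a y in auto)
      have "f (word_value G (case_sum a y) w) = word_value K (f \<circ> case_sum a y) w"
        using word_value_hom[OF assms(2) grp hom, of w "case_sum a y"] mem by simp
      also have "\<dots> = word_value K (case_sum (f \<circ> a) x) w"
      proof (rule word_value_cong)
        fix l assume l: "l \<in> set w"
        show "(f \<circ> case_sum a y) (fst l) = case_sum (f \<circ> a) x (fst l)"
          by (rule wf_system_letter[OF wf w l]) (use y in auto)
      qed
      also have "\<dots> = f \<one>"
        using sol[OF w] by (simp add: eval_word_eq_word_value one)
      finally show ?thesis
        using inj_onD[OF f] word_value_closed[of w "case_sum a y"] mem by (simp add: eval_word_eq_word_value)
    qed
    with y(1) show "\<exists>x\<in>{..<n} \<rightarrow> carrier G. \<forall>w\<in>set ws. eval_word G a x w = \<one>"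
      by blast
  qed
qed

section \<open>Wreath products\<close>

lemma carrier_wreath: "carrier (wreath H G) = (carrier G \<rightarrow>\<^sub>E carrier H) \<times> carrier G"
  by (simp add: wreath_def)

lemma one_wreath: "\<one>\<^bsub>wreath H G\<^esub> = (\<lambda>x\<in>carrier G. \<one>\<^bsub>H\<^esub>, \<one>\<^bsub>G\<^esub>)"
  by (simp add: wreath_def)

lemma fst_mult_wreath:
  "fst (u \<otimes>\<^bsub>wreath H G\<^esub> v) = (\<lambda>x\<in>carrier G. fst u x \<otimes>\<^bsub>H\<^esub> fst v (x \<otimes>\<^bsub>G\<^esub> snd u))"
  by (simp add: wreath_def case_prod_beta)

lemma snd_mult_wreath: "snd (u \<otimes>\<^bsub>wreath H G\<^esub> v) = snd u \<otimes>\<^bsub>G\<^esub> snd v"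
  by (simp add: wreath_def case_prod_beta)

lemma wreath_group:
  assumes "group H" "group G"
  shows "group (wreath H G)"
proof -
  interpret H: group H by fact
  interpret G: group G by fact
  have mem: "fst u x \<in> carrier H" if "u \<in> carrier (wreath H G)" "x \<in> carrier G" for u x
    using that by (auto simp: carrier_wreath)
  have mem': "snd u \<in> carrier G" if "u \<in> carrier (wreath H G)" for u
    using that by (auto simp: carrier_wreath)
  have memI: "u \<in> carrier (wreath H G)"
    if "\<And>x. x \<in> carrier G \<Longrightarrow> fst u x \<in> carrier H" "fst u \<in> extensional (carrier G)" "snd u \<in> carrier G" for u
    using that by (simp add: carrier_wreath mem_Times_iff PiE_iff)
  have eqI: "u = v"
    if "\<And>x. x \<in> carrier G \<Longrightarrow> fst u x = fst v x" "snd u = snd v"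
      "fst u \<in> extensional (carrier G)" "fst v \<in> extensional (carrier G)" for u v :: "('c \<Rightarrow> 'a) \<times> 'c"
    using that by (intro prod_eqI) (auto intro: extensionalityI)
  have ext: "fst u \<in> extensional (carrier G)" if "u \<in> carrier (wreath H G)" for u
    using that by (simp add: carrier_wreath mem_Times_iff PiE_iff)
  show ?thesis
  proof (rule groupI)
    fix u v assume "u \<in> carrier (wreath H G)" "v \<in> carrier (wreath H G)"
    then show "u \<otimes>\<^bsub>wreath H G\<^esub> v \<in> carrier (wreath H G)"
      by (intro memI) (simp_all add: fst_mult_wreath snd_mult_wreath mem mem')
  next
    show "\<one>\<^bsub>wreath H G\<^esub> \<in> carrier (wreath H G)"
      by (intro memI) (simp_all add: one_wreath)
  next
    fix u v w assume "u \<in> carrier (wreath H G)" "v \<in> carrier (wreath H G)" "w \<in> carrier (wreath H G)"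
    then show "u \<otimes>\<^bsub>wreath H G\<^esub> v \<otimes>\<^bsub>wreath H G\<^esub> w = u \<otimes>\<^bsub>wreath H G\<^esub> (v \<otimes>\<^bsub>wreath H G\<^esub> w)"
      by (intro eqI) (simp_all add: fst_mult_wreath snd_mult_wreath mem mem' G.m_assoc H.m_assoc)
  next
    fix u assume u: "u \<in> carrier (wreath H G)"
    then show "\<one>\<^bsub>wreath H G\<^esub> \<otimes>\<^bsub>wreath H G\<^esub> u = u"
      by (intro eqI) (simp_all add: fst_mult_wreath snd_mult_wreath one_wreath mem mem' ext)
    \<comment> \<open>The inverse of (f, g) is (g^-1.f^-1, g^-1), and the action of g^-1 reads a
      function at x g^-1.\<close>
    define v where "v = (\<lambda>x\<in>carrier G. inv\<^bsub>H\<^esub> (fst u (x \<otimes>\<^bsub>G\<^esub> inv\<^bsub>G\<^esub> (snd u))), inv\<^bsub>G\<^esub> (snd u))"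
    have "v \<in> carrier (wreath H G)"
      using u by (intro memI) (simp_all add: v_def mem mem')
    moreover have "v \<otimes>\<^bsub>wreath H G\<^esub> u = \<one>\<^bsub>wreath H G\<^esub>"
      using u by (intro eqI) (simp_all add: v_def fst_mult_wreath snd_mult_wreath one_wreath mem mem')
    ultimately show "\<exists>v\<in>carrier (wreath H G). v \<otimes>\<^bsub>wreath H G\<^esub> u = \<one>\<^bsub>wreath H G\<^esub>"
      by blast
  qed
qed

text \<open>With a coordinate projection of a power as \<open>h\<close>, this extracts one of the
  base functions handled simultaneously and keeps the second component.\<close>

lemma wreath_map_hom:
  assumes "group H" "group G" "h \<in> hom H K"
  shows "(\<lambda>u. (\<lambda>x\<in>carrier G. h (fst u x), snd u)) \<in> hom (wreath H G) (wreath K G)"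
proof -
  interpret H: group H by fact
  interpret G: group G by fact
  show ?thesis
    using assms(3) by (auto simp: hom_def wreath_def PiE_iff Pi_iff intro!: restrict_ext)
qed

section \<open>Finite quotients, exhaustions and boundaries\<close>

text \<open>Distinct g, g' in \<open>S\<close> are separated by a finite-index normal subgroup
  missing g g'^-1. The product of these finitely many quotients separates all pairs; it replaces the
  quotient by the intersection, so \<open>\<psi>\<close> need not be onto.\<close>

lemma finite_quotient_separating:
  fixes G :: "('a, 'b) monoid_scheme" (structure)
  assumes "group G" "residually_finite G" "finite S" "S \<subseteq> carrier G"
  obtains Q :: "('a set \<Rightarrow> 'a set) monoid" and \<psi>
  where "group Q" "finite (carrier Q)" "\<psi> \<in> hom G Q" "inj_on \<psi> S"
proof -
  interpret group G by fact
  define T where "T = {p \<in> S \<times> S. fst p \<noteq> snd p}"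
  have finT: "finite T"
    using assms(3) by (simp add: T_def)
  have "\<exists>N. N \<lhd> G \<and> finite (rcosets N) \<and> fst p \<otimes> inv (snd p) \<notin> N" if "p \<in> T" for p
  proof -
    have "fst p \<in> carrier G" "snd p \<in> carrier G" "fst p \<noteq> snd p"
      using that assms(4) by (auto simp: T_def)
    then have "fst p \<otimes> inv (snd p) \<in> carrier G" "fst p \<otimes> inv (snd p) \<noteq> \<one>"
      using inv_solve_right' by auto
    then show ?thesis
      using assms(2) by (auto simp: residually_finite_def)
  qed
  then obtain N where N: "\<And>p. p \<in> T \<Longrightarrow> N p \<lhd> G" "\<And>p. p \<in> T \<Longrightarrow> finite (rcosets (N p))"
      "\<And>p. p \<in> T \<Longrightarrow> fst p \<otimes> inv (snd p) \<notin> N p"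
    by metis
  define Q where "Q = product_group (N ` T) (\<lambda>N. G Mod N)"
  define \<psi> where "\<psi> = (\<lambda>g. \<lambda>N\<in>N ` T. N #> g)"
  have normal_factor: "group (G Mod N p)" if "p \<in> T" for p
    using N(1)[OF that] by (rule normal.factorgroup_is_group)
  have "group Q"
    unfolding Q_def by (rule product_group) (auto intro: normal_factor)
  moreover have "finite (carrier Q)"
    using finT N(2) by (auto simp: Q_def FactGroup_def intro!: finite_PiE)
  moreover have "\<psi> \<in> hom G Q"
  proof -
    have c: "N p #> g \<in> carrier (G Mod N p)" if "p \<in> T" "g \<in> carrier G" for p g
      using normal.r_coset_hom_Mod[OF N(1)[OF that(1)]] that(2) by (auto simp: hom_def)
    have m: "N p #> (g \<otimes> g') = (N p #> g) \<otimes>\<^bsub>G Mod N p\<^esub> (N p #> g')"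
      if "p \<in> T" "g \<in> carrier G" "g' \<in> carrier G" for p g g'
      using normal.r_coset_hom_Mod[OF N(1)[OF that(1)]] that(2,3) by (auto simp: hom_def)
    show ?thesis
      using c m by (auto simp del: mult_FactGroup simp: hom_def Q_def \<psi>_def intro!: restrict_ext)
  qed
  moreover have "inj_on \<psi> S"
  proof (rule inj_onI, rule ccontr)
    fix g g' assume g: "g \<in> S" "g' \<in> S" "\<psi> g = \<psi> g'" "g \<noteq> g'"
    then have p: "(g, g') \<in> T"
      by (simp add: T_def)
    interpret Np: normal "N (g, g')" G
      using N(1)[OF p] .
    have "N (g, g') #> g = N (g, g') #> g'"
      using fun_cong[OF g(3), of "N (g, g')"] p by (simp add: \<psi>_def)
    then have "g \<otimes> inv g' \<in> N (g, g')"
      using g(1,2) assms(4) Np.rcos_module_imp[OF is_group] rcos_self[OF _ Np.subgroup_axioms]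
      by (metis subsetD)
    then show False
      using N(3)[OF p] by simp
  qed
  ultimately show thesis
    by (rule that)
qed

text \<open>Two factors per step: a boundary point of one set may lie one factor outside it, its
  neighbours another factor further, and the next set has to contain them all.\<close>

lemma (in group) finite_exhaustion:
  assumes "finite E" "E \<subseteq> carrier G"
  obtains D :: "nat \<Rightarrow> 'a set"
  where "\<And>i. finite (D i)" "\<And>i. D i \<subseteq> carrier G" "E \<subseteq> D 0"
    "\<And>i x g h. x \<in> D i \<Longrightarrow> g \<in> E \<Longrightarrow> h \<in> E \<Longrightarrow> x \<otimes> g \<otimes> h \<in> D (Suc i)"
proof -
  define D where "D = rec_nat E (\<lambda>_ Y. (\<lambda>(x, g, h). x \<otimes> g \<otimes> h) ` (Y \<times> E \<times> E))"
  have [simp]: "D 0 = E" "D (Suc i) = (\<lambda>(x, g, h). x \<otimes> g \<otimes> h) ` (D i \<times> E \<times> E)" for i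
    by (simp_all add: D_def)
  have "finite (D i)" "D i \<subseteq> carrier G" for i
    using assms by (induction i) auto
  moreover have "x \<otimes> g \<otimes> h \<in> D (Suc i)" if "x \<in> D i" "g \<in> E" "h \<in> E" for i x g h
    using that by force
  ultimately show thesis
    by (intro that[of D]) auto
qed

text \<open>The product of (f, g) and (f', g') reads f at \<open>s\<close> and f' at s g. With
  functions extended by 1 outside \<open>K\<close> and g in \<open>F\<close>, the readings are both
  genuine or both trivial unless \<open>s\<close> lies in this set.\<close>

definition (in group) boundary :: "'a set \<Rightarrow> 'a set \<Rightarrow> 'a set" where
  "boundary F K = {s \<in> carrier G. \<exists>g\<in>F. (s \<in> K) \<noteq> (s \<otimes> g \<in> K)}"

text \<open>A boundary point of \<open>K i\<close> lies in \<open>K i\<close> or is moved into it by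
  some g in \<open>F\<close>; either way it is x h with x in \<open>K i\<close> and h in
  \<open>F\<close>. So it and all its neighbours lie in \<open>K (Suc i)\<close>, hence in
  \<open>K j\<close>, and it is not on the boundary of \<open>K j\<close>.\<close>

lemma (in group) boundaries_disjoint:
  assumes F: "F \<subseteq> carrier G" "\<one> \<in> F" "\<And>g. g \<in> F \<Longrightarrow> inv g \<in> F"
    and K: "\<And>i. K i \<subseteq> carrier G"
      "\<And>i x g h. x \<in> K i \<Longrightarrow> g \<in> F \<Longrightarrow> h \<in> F \<Longrightarrow> x \<otimes> g \<otimes> h \<in> K (Suc i)"
    and "i < j"
  shows "boundary F (K i) \<inter> boundary F (K j) = {}"
proof -
  have "K i \<subseteq> K (Suc i)" for i
    using K(2)[OF _ F(2) F(2)] K(1) by force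
  then have mono: "K i \<subseteq> K j" if "i \<le> j" for i j
    using that by (rule lift_Suc_mono_le)
  have "s \<notin> boundary F (K j)" if b: "s \<in> boundary F (K i)" for s
  proof -
    obtain g where g: "g \<in> F" "(s \<in> K i) \<noteq> (s \<otimes> g \<in> K i)" and s: "s \<in> carrier G"
      using b unfolding boundary_def by blast
    obtain x h where xh: "x \<in> K i" "h \<in> F" "s = x \<otimes> h"
    proof (cases "s \<in> K i")
      case True
      then show ?thesis
        using that[of s \<one>] F(2) s by simp
    next
      case False
      then show ?thesis
        using that[of "s \<otimes> g" "inv g"] F g s inv_solve_right[of s "s \<otimes> g" g] by (simp add: subset_iff)
    qed
    have "s \<otimes> h' \<in> K j" if "h' \<in> F" for h'
      using K(2)[OF xh(1,2) that] mono[of "Suc i" j] xh(3) \<open>i < j\<close> by auto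
    moreover from this[OF F(2)] have "s \<in> K j"
      using s by simp
    ultimately show ?thesis
      by (auto simp: boundary_def)
  qed
  then show ?thesis
    by blast
qed

text \<open>If every \<open>B i\<close> met \<open>T\<close>, points chosen in the intersections
  would be distinct by disjointness, giving \<open>M\<close> elements of \<open>T\<close>.\<close>

lemma disjoint_family_avoids:
  assumes "finite T" "card T < M" "\<And>i j. i < j \<Longrightarrow> B i \<inter> B j = {}"
  obtains i :: nat where "i < M" "B i \<inter> T = {}"
proof (rule ccontr)
  assume "\<not> thesis"
  with that have "\<forall>i\<in>{..<M}. \<exists>t. t \<in> B i \<inter> T"
    by blast
  then obtain t where t: "\<And>i. i < M \<Longrightarrow> t i \<in> B i \<inter> T"
    by (metis lessThan_iff)
  have "inj_on t {..<M}"
    proof (rule linorder_inj_onI)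
    fix i j :: nat assume "i < j" "i \<in> {..<M}" "j \<in> {..<M}"
    then show "t i \<noteq> t j"
      using t[of i] t[of j] assms(3)[of i j] by auto
  qed auto
  moreover have "t ` {..<M} \<subseteq> T"
    using t by auto
  ultimately have "card {..<M} \<le> card T"
    using assms(1) card_inj_on_le by blast
  with assms(2) show False
    by simp
qed

section \<open>Finite approximations of the wreath product\<close>

text \<open>The letter \<open>Inr (a, j)\<close> stands for the value of the variable \<open>x\<^sub>j\<close> in a solution for the tuple \<open>a\<close>
  of constants.\<close>

type_synonym 'a alphabet = "'a + 'a list \<times> nat"

text \<open>Tuples are lists rather than functions on \<open>nat\<close>: they occur in letters, and
  the words over an infinite type must inject into that type.\<close>

definition constant_tuple :: "('a, 'b) monoid_scheme \<Rightarrow> nat \<Rightarrow> 'a list \<Rightarrow> bool" where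
  "constant_tuple G k a \<longleftrightarrow> length a = k \<and> set a \<subseteq> carrier G"

definition instance_value ::
  "('b, 'c) monoid_scheme \<Rightarrow> ('a alphabet \<Rightarrow> 'b) \<Rightarrow> 'a list \<Rightarrow> word \<Rightarrow> 'b" where
  "instance_value P e a w = word_value P (case_sum (\<lambda>i. e (Inl (a ! i))) (\<lambda>j. e (Inr (a, j)))) w"

text \<open>\<open>e\<close> sends letters to the wreath product of \<open>H\<close> and \<open>Q\<close>, but its multiplicativity on constants is only required at
  the points of \<open>Q\<close> produced by the words in \<open>W\<close>.\<close>

definition finite_approximation ::
  "('h, 'c) monoid_scheme \<Rightarrow> ('g, 'd) monoid_scheme \<Rightarrow> nat \<Rightarrow> word list \<Rightarrow> 'g set \<Rightarrow>
   ((('g \<Rightarrow> 'h) \<times> 'g) alphabet \<times> bool) list set \<Rightarrow> ('q, 'f) monoid_scheme \<Rightarrow>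
   ((('g \<Rightarrow> 'h) \<times> 'g) alphabet \<Rightarrow> ('q \<Rightarrow> 'h) \<times> 'q) \<Rightarrow> bool" where
  "finite_approximation H G k ws E W Q e \<longleftrightarrow>
     group Q \<and> range e \<subseteq> carrier (wreath H Q) \<and>
     (\<forall>a. constant_tuple (wreath H G) k a \<longrightarrow>
        (\<forall>w\<in>set ws. instance_value (wreath H Q) e a w = \<one>\<^bsub>wreath H Q\<^esub>)) \<and>
     (\<forall>u\<in>carrier (wreath H G). \<forall>v\<in>carrier (wreath H G).
        snd (e (Inl (u \<otimes>\<^bsub>wreath H G\<^esub> v))) = snd (e (Inl u)) \<otimes>\<^bsub>Q\<^esub> snd (e (Inl v)) \<and>
        (snd u \<in> E \<longrightarrow> (\<forall>t\<in>W. let s = snd (word_value (wreath H Q) e t) in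
           fst (e (Inl (u \<otimes>\<^bsub>wreath H G\<^esub> v))) s = fst (e (Inl u) \<otimes>\<^bsub>wreath H Q\<^esub> e (Inl v)) s)) \<and>
        (snd u \<in> E \<longrightarrow> snd v \<in> E \<longrightarrow> snd (e (Inl u)) = snd (e (Inl v)) \<longrightarrow> snd u = snd v) \<and>
        (snd v \<in> E \<longrightarrow> fst (e (Inl u)) (snd (e (Inl v))) = fst u (snd v)))"

text \<open>The order of choices matters: \<open>W\<close> fixes the number \<open>M\<close> of
  candidate sets, then \<open>Q\<close> and the solutions are chosen for all candidates at once, and
  only then is the index \<open>i\<close> selected.\<close>

lemma finite_approximation_exists:
  fixes H :: "('h, 'c) monoid_scheme" and G :: "('g, 'd) monoid_scheme"
  assumes H: "group H" "finite (carrier H)"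
    and G: "group G" "residually_finite G"
    and sys: "SysFin k n ws"
    and E: "finite E" "E \<subseteq> carrier G" and W: "finite W"
  shows "\<exists>(Q :: ('g set \<Rightarrow> 'g set) monoid) e. finite_approximation H G k ws E W Q e"
proof -
  interpret H: group H by fact
  interpret G: group G by fact
  let ?\<Gamma> = "wreath H G"
  interpret \<Gamma>: group ?\<Gamma>
    by (rule wreath_group) fact+
  have wf: "wf_system k n ws"
    using sys by (simp add: SysFin_def)
  define E' where "E' = insert \<one>\<^bsub>G\<^esub> (E \<union> m_inv G ` E)"
  have E': "finite E'" "E' \<subseteq> carrier G" "\<one>\<^bsub>G\<^esub> \<in> E'" "E \<subseteq> E'"
    using E by (auto simp: E'_def)
  have E'_inv: "inv\<^bsub>G\<^esub> g \<in> E'" if "g \<in> E'" for g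
    using E that by (auto simp: E'_def)
  obtain D where D: "\<And>i. finite (D i)" "\<And>i. D i \<subseteq> carrier G" "E' \<subseteq> D 0"
    "\<And>i x g h. x \<in> D i \<Longrightarrow> g \<in> E' \<Longrightarrow> h \<in> E' \<Longrightarrow> x \<otimes>\<^bsub>G\<^esub> g \<otimes>\<^bsub>G\<^esub> h \<in> D (Suc i)"
    using G.finite_exhaustion[OF E'(1,2)] by blast
  have "D i \<subseteq> D (Suc i)" for i
    using D(4)[OF _ E'(3) E'(3)] D(2) by force
  then have "D 0 \<subseteq> D i" for i
    by (rule lift_Suc_mono_le) simp
  \<comment> \<open>Whichever \<open>i\<close> is selected later, \<open>\<psi>\<close> will be
    injective and the transport exact on \<open>E\<close>.\<close>
  with D(3) E'(4) have E_D: "E \<subseteq> D i" for i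
    by blast
  \<comment> \<open>One more than the number of points of \<open>Q\<close> that the words in
    \<open>W\<close> can produce; this bound is known before \<open>Q\<close> is.\<close>
  define M where "M = Suc (card W)"
  \<comment> \<open>The products x g are included because injectivity must later identify x g with
    an element of \<open>D i\<close> that has the same image.\<close>
  define S where "S = (\<Union>i<M. D i \<union> (\<lambda>(x, g). x \<otimes>\<^bsub>G\<^esub> g) ` (D i \<times> E'))"
  have "finite S"
    using D(1) E'(1) by (auto simp: S_def)
  moreover have "S \<subseteq> carrier G"
    using D(2) E'(2) by (fastforce simp: S_def)
  ultimately obtain Q :: "('g set \<Rightarrow> 'g set) monoid" and \<psi>
    where Q: "group Q" "finite (carrier Q)" and \<psi>: "\<psi> \<in> hom G Q" "inj_on \<psi> S"
    using finite_quotient_separating[OF G] by blast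
  interpret Q: group Q by fact
  interpret \<psi>: group_hom G Q \<psi>
    using \<psi>(1) by (simp add: group_hom_def group_hom_axioms_def G.is_group Q.is_group)
  define HM where "HM = product_group {..<M} (\<lambda>_. H)"
  have HM: "group HM" "finite (carrier HM)"
    using H by (auto simp: HM_def intro: finite_PiE)
  define P where "P = wreath HM Q"
  interpret P: group P
    unfolding P_def by (rule wreath_group) fact+
  have finP: "finite (carrier P)"
    using HM(2) Q(2) by (auto simp: P_def carrier_wreath intro: finite_PiE)

  \<comment> \<open>The default 1 makes both sides of the product rule trivial where both readings
    fall outside the image of \<open>D i\<close>.\<close>
  define tr where "tr i f s = (if s \<in> \<psi> ` D i then f (inv_into (D i) \<psi> s) else \<one>\<^bsub>H\<^esub>)"
    for i and f :: "'g \<Rightarrow> 'h" and s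
  have inj_D: "inj_on \<psi> (D i)" if "i < M" for i
    using \<psi>(2) that by (auto simp: S_def intro: inj_on_subset)
  have tr_eq: "tr i f (\<psi> x) = f x" if "i < M" "x \<in> D i" for i f x
    using that inj_D by (simp add: tr_def inv_into_f_f)
  have tr_closed: "tr i f s \<in> carrier H" if "f \<in> carrier G \<rightarrow> carrier H" for i f s
    using that D(2)[of i] inv_into_into[of s \<psi> "D i"] by (auto simp: tr_def Pi_iff)
  define \<theta> where "\<theta> u = (\<lambda>s\<in>carrier Q. \<lambda>i\<in>{..<M}. tr i (fst u) s, \<psi> (snd u))" for u
  have \<theta>_closed: "\<theta> u \<in> carrier P" if "u \<in> carrier ?\<Gamma>" for u
  proof -
    have "fst u \<in> carrier G \<rightarrow> carrier H" "snd u \<in> carrier G"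
      using that by (simp_all add: carrier_wreath mem_Times_iff PiE_iff Pi_iff)
    then show ?thesis
      using tr_closed by (auto simp: \<theta>_def P_def HM_def carrier_wreath)
  qed

  \<comment> \<open>\<open>\<theta>\<close> need not be a homomorphism: the system is solvable in
    the finite group \<open>P\<close> for all constants, in particular for these.\<close>
  have "\<exists>x\<in>{..<n} \<rightarrow> carrier P. \<forall>w\<in>set ws. eval_word P (\<lambda>i. \<theta> (a ! i)) x w = \<one>\<^bsub>P\<^esub>"
    if "constant_tuple ?\<Gamma> k a" for a
  proof -
    have "(\<lambda>i. \<theta> (a ! i)) \<in> {..<k} \<rightarrow> carrier P"
      using that by (auto simp: constant_tuple_def intro!: \<theta>_closed)
    then show ?thesis
      using SysFin_finite_group[OF sys P.is_group finP] by (simp add: solvable_in_def)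
  qed
  then obtain xs where *: "\<And>a. constant_tuple ?\<Gamma> k a \<Longrightarrow> xs a \<in> {..<n} \<rightarrow> carrier P \<and>
      (\<forall>w\<in>set ws. eval_word P (\<lambda>i. \<theta> (a ! i)) (xs a) w = \<one>\<^bsub>P\<^esub>)"
    unfolding Bex_def by metis
  have xs: "xs a j \<in> carrier P" if "constant_tuple ?\<Gamma> k a" "j < n" for a j
    using *[OF that(1)] that(2) by (auto simp: Pi_iff)
  have sol: "word_value P (case_sum (\<lambda>i. \<theta> (a ! i)) (xs a)) w = \<one>\<^bsub>P\<^esub>"
    if "constant_tuple ?\<Gamma> k a" "w \<in> set ws" for a w
    using *[OF that(1)] that(2) by (simp add: eval_word_eq_word_value)
  \<comment> \<open>The default 1 on meaningless letters keeps every value in \<open>P\<close>, so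
    that all words can be evaluated.\<close>
  define c :: "(('g \<Rightarrow> 'h) \<times> 'g) alphabet \<Rightarrow> _" where
    "c l = (case l of Inl u \<Rightarrow> if u \<in> carrier ?\<Gamma> then \<theta> u else \<one>\<^bsub>P\<^esub>
       | Inr (a, j) \<Rightarrow> if constant_tuple ?\<Gamma> k a \<and> j < n then xs a j else \<one>\<^bsub>P\<^esub>)" for l
  have c_closed: "c l \<in> carrier P" for l
    using \<theta>_closed xs by (auto simp: c_def split: sum.split)
  have inst: "instance_value P c a w = \<one>\<^bsub>P\<^esub>" if a: "constant_tuple ?\<Gamma> k a" and w: "w \<in> set ws" for a w
  proof -
    have "instance_value P c a w = word_value P (case_sum (\<lambda>i. \<theta> (a ! i)) (xs a)) w"
      unfolding instance_value_def
    proof (rule word_value_cong)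
      fix l assume l: "l \<in> set w"
      show "(case fst l of Inl i \<Rightarrow> c (Inl (a ! i)) | Inr j \<Rightarrow> c (Inr (a, j))) =
          (case fst l of Inl i \<Rightarrow> \<theta> (a ! i) | Inr j \<Rightarrow> xs a j)"
      proof (rule wf_system_letter[OF wf w l])
        fix i assume "i < k"
        then have "a ! i \<in> carrier ?\<Gamma>"
          using a by (auto simp: constant_tuple_def)
        then show "(case Inl i of Inl i \<Rightarrow> c (Inl (a ! i)) | Inr j \<Rightarrow> c (Inr (a, j))) =
            (case Inl i of Inl i \<Rightarrow> \<theta> (a ! i) | Inr j \<Rightarrow> xs a j)"
          by (simp add: c_def)
      qed (use a in \<open>simp add: c_def\<close>)
    qed
    with sol[OF a w] show ?thesis
      by simp
  qed

  \<comment> \<open>These points are found in \<open>P\<close>, before \<open>i\<close> is known;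
    the projection \<open>pr\<close> to coordinate \<open>i\<close> will not move them, since it
    keeps the \<open>Q\<close>-component.\<close>
  define T where "T = (\<lambda>t. snd (word_value P c t)) ` W"
  have "finite T" "card T < M"
    using W by (auto simp: T_def M_def less_Suc_eq_le card_image_le)
  then obtain i where i: "i < M" "Q.boundary (\<psi> ` E') (\<psi> ` D i) \<inter> T = {}"
  proof (rule disjoint_family_avoids)
    fix i j :: nat assume "i < j"
    show "Q.boundary (\<psi> ` E') (\<psi> ` D i) \<inter> Q.boundary (\<psi> ` E') (\<psi> ` D j) = {}"
    proof (rule Q.boundaries_disjoint[where K = "\<lambda>i. \<psi> ` D i"])
      show "\<psi> ` E' \<subseteq> carrier Q" "\<psi> ` D i \<subseteq> carrier Q" for i
        using E'(2) D(2)[of i] by auto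
      show "\<one>\<^bsub>Q\<^esub> \<in> \<psi> ` E'"
        using E'(3) \<psi>.hom_one by (metis imageI)
      show "inv\<^bsub>Q\<^esub> g \<in> \<psi> ` E'" if "g \<in> \<psi> ` E'" for g
        using that E'(2) E'_inv by (auto simp flip: \<psi>.hom_inv simp: subset_iff)
      show "x \<otimes>\<^bsub>Q\<^esub> g \<otimes>\<^bsub>Q\<^esub> h \<in> \<psi> ` D (Suc i)"
        if xgh: "x \<in> \<psi> ` D i" "g \<in> \<psi> ` E'" "h \<in> \<psi> ` E'" for i x g h
      proof -
        obtain x' g' h' where *: "x = \<psi> x'" "g = \<psi> g'" "h = \<psi> h'" "x' \<in> D i" "g' \<in> E'" "h' \<in> E'"
          using xgh by blast
        then have "x \<otimes>\<^bsub>Q\<^esub> g \<otimes>\<^bsub>Q\<^esub> h = \<psi> (x' \<otimes>\<^bsub>G\<^esub> g' \<otimes>\<^bsub>G\<^esub> h')"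
          using E'(2) D(2)[of i] by (simp add: subset_iff)
        with D(4)[OF *(4-6)] show ?thesis
          by simp
      qed
    qed fact
  qed

  let ?R = "wreath H Q"
  interpret R: group ?R
    by (rule wreath_group) fact+
  define pr where "pr u = (\<lambda>s\<in>carrier Q. fst u s i, snd u)" for u :: "(('g set \<Rightarrow> 'g set) \<Rightarrow> nat \<Rightarrow> 'h) \<times> ('g set \<Rightarrow> 'g set)"
  have pr: "pr \<in> hom P ?R"
    unfolding pr_def P_def
    by (rule wreath_map_hom[OF HM(1) Q(1)]) (use i(1) in \<open>auto simp: hom_def HM_def\<close>)
  define e where "e = pr \<circ> c"
  have e_closed: "e l \<in> carrier ?R" for l
    using hom_in_carrier[OF pr] c_closed by (simp add: e_def)
  have e_value: "word_value ?R e t = pr (word_value P c t)" for t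
    unfolding e_def by (rule word_value_hom[OF P.is_group R.is_group pr c_closed])
  have fst_e: "fst (e (Inl u)) s = tr i (fst u) s" if "u \<in> carrier ?\<Gamma>" "s \<in> carrier Q" for u s
    using that i(1) by (simp add: e_def pr_def c_def \<theta>_def)
  have snd_e: "snd (e (Inl u)) = \<psi> (snd u)" if "u \<in> carrier ?\<Gamma>" for u
    using that by (simp add: e_def pr_def c_def \<theta>_def)

  have sol_e: "instance_value ?R e a w = \<one>\<^bsub>?R\<^esub>" if "constant_tuple ?\<Gamma> k a" "w \<in> set ws" for a w
  proof -
    have "instance_value ?R e a w = word_value ?R (pr \<circ> case_sum (\<lambda>i. c (Inl (a ! i))) (\<lambda>j. c (Inr (a, j)))) w"
      unfolding instance_value_def e_def by (rule word_value_cong) (simp split: sum.split)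
    also have "\<dots> = pr (instance_value P c a w)"
      unfolding instance_value_def
      by (rule word_value_hom[OF P.is_group R.is_group pr]) (simp add: c_closed split: sum.split)
    finally show ?thesis
      using inst[OF that] hom_one[OF pr P.is_group R.is_group] by simp
  qed
  have snd_mult: "snd (e (Inl (u \<otimes>\<^bsub>?\<Gamma>\<^esub> v))) = snd (e (Inl u)) \<otimes>\<^bsub>Q\<^esub> snd (e (Inl v))"
    if "u \<in> carrier ?\<Gamma>" "v \<in> carrier ?\<Gamma>" for u v
  proof -
    have "snd u \<in> carrier G" "snd v \<in> carrier G"
      using that by (simp_all add: carrier_wreath mem_Times_iff)
    with that show ?thesis
      by (simp add: snd_e snd_mult_wreath)
  qed
  have fst_mult: "fst (e (Inl (u \<otimes>\<^bsub>?\<Gamma>\<^esub> v))) s = fst (e (Inl u) \<otimes>\<^bsub>?R\<^esub> e (Inl v)) s"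
    if u: "u \<in> carrier ?\<Gamma>" and v: "v \<in> carrier ?\<Gamma>" and uE: "snd u \<in> E"
      and t: "t \<in> W" and s: "s = snd (word_value ?R e t)" for u v t s
  proof -
    have uG: "snd u \<in> carrier G" and uE': "snd u \<in> E'"
      using uE E' by auto
    have s': "s = snd (word_value P c t)"
      by (simp add: s e_value pr_def)
    then have sQ: "s \<in> carrier Q"
      using P.word_value_closed[of t c] c_closed by (auto simp: P_def carrier_wreath)
    have "s \<in> T"
      using t by (simp add: s' T_def)
    with i(2) have "s \<notin> Q.boundary (\<psi> ` E') (\<psi> ` D i)"
      by blast
    \<comment> \<open>Avoiding the boundary leaves two cases: both points read by the product lie in
      the image of \<open>D i\<close> and lift to \<open>G\<close>, or both lie outside, where all
      values are 1.\<close>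
    with sQ uE' have iff: "s \<in> \<psi> ` D i \<longleftrightarrow> s \<otimes>\<^bsub>Q\<^esub> \<psi> (snd u) \<in> \<psi> ` D i"
      unfolding Q.boundary_def by blast
    have R: "fst (e (Inl u) \<otimes>\<^bsub>?R\<^esub> e (Inl v)) s = tr i (fst u) s \<otimes>\<^bsub>H\<^esub> tr i (fst v) (s \<otimes>\<^bsub>Q\<^esub> \<psi> (snd u))"
      using sQ u v uG by (simp add: fst_mult_wreath fst_e snd_e)
    have L: "fst (e (Inl (u \<otimes>\<^bsub>?\<Gamma>\<^esub> v))) s = tr i (fst (u \<otimes>\<^bsub>?\<Gamma>\<^esub> v)) s"
      using sQ u v by (simp add: fst_e)
    show ?thesis
    proof (cases "s \<in> \<psi> ` D i")
      case True
      then obtain x where x: "x \<in> D i" "s = \<psi> x"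
        by blast
      then have xG: "x \<in> carrier G"
        using D(2) by blast
      from True iff obtain y where y: "y \<in> D i" "s \<otimes>\<^bsub>Q\<^esub> \<psi> (snd u) = \<psi> y"
        by blast
      have "\<psi> (x \<otimes>\<^bsub>G\<^esub> snd u) = \<psi> y"
        using y(2) x(2) xG uG by simp
      moreover have "y \<in> S" "x \<otimes>\<^bsub>G\<^esub> snd u \<in> S"
        using x(1) y(1) i(1) uE' by (auto simp: S_def)
      ultimately have "x \<otimes>\<^bsub>G\<^esub> snd u = y"
        using \<psi>(2) by (auto dest: inj_onD)
      then show ?thesis
        unfolding L R y(2) using x y(1) i(1) xG by (simp add: tr_eq fst_mult_wreath)
    next
      case False
      with iff show ?thesis
        by (simp add: L R tr_def)
    qed
  qed
  have snd_inj: "snd u = snd v"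
    if "u \<in> carrier ?\<Gamma>" "v \<in> carrier ?\<Gamma>" "snd u \<in> E" "snd v \<in> E" "snd (e (Inl u)) = snd (e (Inl v))" for u v
    using that inj_D[OF i(1)] E_D[of i] by (auto simp: snd_e dest: inj_onD)
  have fst_eval: "fst (e (Inl u)) (snd (e (Inl v))) = fst u (snd v)"
    if "u \<in> carrier ?\<Gamma>" "v \<in> carrier ?\<Gamma>" "snd v \<in> E" for u v
  proof -
    have "snd v \<in> D i" "snd v \<in> carrier G"
      using that E_D[of i] E(2) by auto
    with that i(1) show ?thesis
      by (simp add: snd_e fst_e tr_eq)
  qed
  have "finite_approximation H G k ws E W Q e"
    unfolding finite_approximation_def Let_def
  proof (intro conjI allI ballI impI)
    show "group Q" "range e \<subseteq> carrier ?R"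
      using Q(1) e_closed by auto
  qed ((rule sol_e snd_mult fst_mult[OF _ _ _ _ refl] fst_eval snd_inj; assumption)+)
  then show ?thesis
    by blast
qed

section \<open>The overgroup as a quotient of words\<close>

text \<open>Words modulo a congruence form a monoid, and left inverses make it a group. A class is
  represented by its value under \<open>c\<close>, so that the group can live on a prescribed
  type.\<close>

lemma quotient_of_words_group:
  fixes c :: "'l list \<Rightarrow> 'b"
  assumes cong: "\<And>u u' v v'. c u = c u' \<Longrightarrow> c v = c v' \<Longrightarrow> c (u @ v) = c (u' @ v')"
    and inverse: "\<And>u. \<exists>v. c (v @ u) = c []"
  obtains L :: "'b monoid"
  where "group L" "carrier L = range c" "\<one>\<^bsub>L\<^esub> = c []" "\<And>u v. c u \<otimes>\<^bsub>L\<^esub> c v = c (u @ v)"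
proof -
  define L where "L = \<lparr>carrier = range c, monoid.mult = (\<lambda>A B. c (inv_into UNIV c A @ inv_into UNIV c B)),
    one = c []\<rparr>"
  have carr: "carrier L = range c" and one: "\<one>\<^bsub>L\<^esub> = c []"
    by (simp_all add: L_def)
  have mult: "c u \<otimes>\<^bsub>L\<^esub> c v = c (u @ v)" for u v
    unfolding L_def using cong[of "inv_into UNIV c (c u)" u "inv_into UNIV c (c v)" v] by (simp add: f_inv_into_f)
  have "group L"
  proof (rule groupI)
    fix A assume "A \<in> carrier L"
    then show "\<exists>B\<in>carrier L. B \<otimes>\<^bsub>L\<^esub> A = \<one>\<^bsub>L\<^esub>"
      using inverse by (auto simp: carr one mult)
  qed (auto simp: carr one mult)
  then show thesis
    using carr one mult by (rule that)
qed

text \<open>Needed because the elements of the overgroup must be sets of elements of the given group.\<close>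

lemma infinite_alphabet_encoding:
  assumes "infinite (UNIV :: 'a set)"
  obtains f :: "('a alphabet \<times> bool) list \<Rightarrow> 'a" where "inj f"
proof -
  obtain N :: "nat \<Rightarrow> 'a" where N: "inj N"
    using infinite_countable_subset[OF assms] by blast
  have "|(UNIV :: 'a set) \<times> (UNIV :: 'a set)| =o |UNIV :: 'a set|"
    by (rule card_of_Times_same_infinite[OF assms])
  then obtain p :: "'a \<times> 'a \<Rightarrow> 'a" where "bij_betw p (UNIV \<times> UNIV) UNIV"
    using card_of_ordIso[of "(UNIV :: 'a set) \<times> (UNIV :: 'a set)" "UNIV :: 'a set"] by blast
  then have p: "p x = p y \<longleftrightarrow> x = y" for x y
    by (metis UNIV_Times_UNIV bij_betw_def inj_eq)
  note N_eq = inj_eq[OF N]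
  \<comment> \<open>The tags \<open>N 0\<close> and \<open>N 1\<close> keep empty and nonempty lists
    apart; in \<open>letter\<close> they separate the two kinds of letters and the signs.\<close>
  define code where "code = rec_list (p (N 0, N 0)) (\<lambda>x _ r. p (N 1, p (x, r)))"
  have code: "code [] = p (N 0, N 0)" "code (x # xs) = p (N 1, p (x, code xs))" for x xs
    by (simp_all add: code_def)
  have code_eq: "code xs = code ys \<longleftrightarrow> xs = ys" for xs ys
  proof (induction xs arbitrary: ys)
    case Nil
    then show ?case by (cases ys) (auto simp: code p N_eq)
  next
    case (Cons x xs)
    then show ?case by (cases ys) (auto simp: code p N_eq)
  qed
  define letter where "letter l = p (N (if snd l then 1 else 0),
      case fst l of Inl a \<Rightarrow> p (N 0, a) | Inr (a, j) \<Rightarrow> p (N 1, p (code a, N j)))"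
    for l :: "'a alphabet \<times> bool"
  have "inj letter"
    by (rule injI) (auto simp: letter_def p N_eq code_eq prod_eq_iff split: sum.splits prod.splits if_splits)
  then have "inj (code \<circ> map letter)"
    by (intro inj_compose injI) (auto simp: code_eq dest: injD)
  then show thesis
    by (rule that)
qed

text \<open>The group itself serves as overgroup, copied to singletons because
  \<open>solvable_over\<close> asks for a group of sets.\<close>

lemma solvable_in_imp_solvable_over:
  fixes G :: "('a, 'b) monoid_scheme"
  assumes "group G" "wf_system k n ws" "solvable_in G k n ws"
  shows "solvable_over G k n ws"
proof -
  define \<phi> :: "'a \<Rightarrow> 'a set" where "\<phi> x = {x}" for x
  define L where "L = image_group \<phi> G"
  have inj: "inj_on \<phi> (carrier G)"
    by (auto simp: \<phi>_def inj_on_def)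
  have L: "group L" "\<phi> \<in> hom G L"
    using group.inj_imp_image_group_is_group[OF assms(1) inj] inj_imp_image_group_iso[OF inj]
    by (auto simp: L_def iso_def)
  have "\<exists>x\<in>{..<n} \<rightarrow> carrier L. \<forall>w\<in>set ws. eval_word L (\<phi> \<circ> a) x w = \<one>\<^bsub>L\<^esub>"
    if a: "a \<in> {..<k} \<rightarrow> carrier G" for a
  proof -
    obtain x where x: "x \<in> {..<n} \<rightarrow> carrier G" "\<And>w. w \<in> set ws \<Longrightarrow> eval_word G a x w = \<one>\<^bsub>G\<^esub>"
      using assms(3) a by (auto simp: solvable_in_def)
    have "eval_word L (\<phi> \<circ> a) (\<phi> \<circ> x) w = \<one>\<^bsub>L\<^esub>" if w: "w \<in> set ws" for w
    proof -
      have "case_sum a x (fst l) \<in> carrier G" if "l \<in> set w" for l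
        by (rule wf_system_letter[OF assms(2) w that]) (use a x in auto)
      then have "word_value L (\<phi> \<circ> case_sum a x) w = \<phi> (word_value G (case_sum a x) w)"
        by (rule word_value_hom[OF assms(1) L])
      then show ?thesis
        using x(2)[OF w] hom_one[OF L(2) assms(1) L(1)]
        by (simp add: eval_word_eq_word_value case_sum_o_inj o_case_sum)
    qed
    moreover have "\<phi> \<circ> x \<in> {..<n} \<rightarrow> carrier L"
      using x(1) hom_in_carrier[OF L(2)] by (auto simp: Pi_iff)
    ultimately show ?thesis
      by blast
  qed
  then show ?thesis
    unfolding solvable_over_def using L inj by blast
qed

text \<open>The properties of \<open>L\<close> are those that hold eventually in the approximations
  for finite sets \<open>W\<close> of words. The infinite type leaves room to code words by its
  elements.\<close>

lemma wreath_solvable_over_infinite: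
  fixes H :: "('h, 'c) monoid_scheme" and G :: "('g, 'd) monoid_scheme"
  assumes inf: "infinite (UNIV :: (('g \<Rightarrow> 'h) \<times> 'g) set)"
    and H: "group H" "finite (carrier H)"
    and G: "group G" "residually_finite G"
    and sys: "SysFin k n ws"
  shows "solvable_over (wreath H G) k n ws"
proof -
  let ?\<Gamma> = "wreath H G"
  interpret \<Gamma>: group ?\<Gamma>
    by (rule wreath_group) fact+
  have wf: "wf_system k n ws"
    using sys by (simp add: SysFin_def)
  define gen where "gen l = [(l, False)]" for l :: "(('g \<Rightarrow> 'h) \<times> 'g) alphabet"
  \<comment> \<open>The finite part of \<open>G\<close> to be respected grows with \<open>W\<close>:
    the component of a constant is included once \<open>W\<close> contains its one-letter
    word.\<close>
  define E where "E W = snd ` {u \<in> carrier ?\<Gamma>. gen (Inl u) \<in> W}" for W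
  have "finite (E W)" if "finite W" for W
  proof -
    have "finite ((\<lambda>u. gen (Inl u)) -` W)"
      by (rule finite_vimageI[OF that]) (auto simp: gen_def intro: injI)
    then have "finite {u \<in> carrier ?\<Gamma>. gen (Inl u) \<in> W}"
      by (rule rev_finite_subset) auto
    then show ?thesis
      by (simp add: E_def)
  qed
  moreover have "E W \<subseteq> carrier G" for W
    by (auto simp: E_def carrier_wreath)
  ultimately have "\<exists>Q e. finite_approximation H G k ws (E W) W (Q :: ('g set \<Rightarrow> 'g set) monoid) e"
    if "finite W" for W
    using finite_approximation_exists[OF H G sys _ _ that] that by simp
  then obtain Q :: "_ \<Rightarrow> ('g set \<Rightarrow> 'g set) monoid" and e
    where approx: "\<And>W. finite W \<Longrightarrow> finite_approximation H G k ws (E W) W (Q W) (e W)"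
    by metis
  define P where "P W = wreath H (Q W)" for W
  have grpQ: "group (Q W)" if "finite W" for W
    using approx[OF that] by (simp add: finite_approximation_def)
  have grp: "group (P W)" if "finite W" for W
    unfolding P_def by (rule wreath_group[OF H(1) grpQ[OF that]])
  have e_closed: "e W l \<in> carrier (P W)" if "finite W" for W l
    using approx[OF that] by (auto simp: finite_approximation_def P_def)
  define ev where "ev W t = word_value (P W) (e W) t" for W t
  have ev_closed: "ev W t \<in> carrier (P W)" if "finite W" for W t
    unfolding ev_def by (rule group.word_value_closed[OF grp[OF that] e_closed[OF that]])
  have snd_ev: "snd (ev W t) \<in> carrier (Q W)" if "finite W" for W t
    using ev_closed[OF that, of t] by (simp add: P_def carrier_wreath mem_Times_iff)
  have ev_append: "ev W (u @ v) = ev W u \<otimes>\<^bsub>P W\<^esub> ev W v" if "finite W" for W u v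
    unfolding ev_def by (rule group.word_value_append[OF grp[OF that] e_closed[OF that]])
  have ev_gen: "ev W (gen l) = e W l" if "finite W" for W l
    using group.is_monoid[OF grp[OF that]] e_closed[OF that]
    by (simp add: ev_def gen_def monoid.r_one)

  let ?F = "finite_subsets_at_top (UNIV :: ((('g \<Rightarrow> 'h) \<times> 'g) alphabet \<times> bool) list set)"
  have ev_finite: "eventually finite ?F"
    by (auto simp: eventually_finite_subsets_at_top)
  have ev_mem: "\<forall>\<^sub>F W in ?F. t \<in> W" for t
    unfolding eventually_finite_subsets_at_top by (intro exI[of _ "{t}"]) auto
  \<comment> \<open>Testing at all points of \<open>Q W\<close> would be too strict: \<open>e W\<close> is multiplicative only at the points produced by words.\<close>
  define same where "same u v \<longleftrightarrow>
      (\<forall>\<^sub>F W in ?F. snd (ev W u) = snd (ev W v)) \<and>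
      (\<forall>t. \<forall>\<^sub>F W in ?F. fst (ev W u) (snd (ev W t)) = fst (ev W v) (snd (ev W t)))" for u v
  have same_sym: "same u v \<Longrightarrow> same v u" for u v
    by (auto simp: same_def eq_commute)
  have same_trans: "same u w" if "same u v" "same v w" for u v w
  proof -
    have "\<forall>\<^sub>F W in ?F. snd (ev W u) = snd (ev W w)"
      using that unfolding same_def by (auto elim: eventually_elim2)
    moreover have "\<forall>\<^sub>F W in ?F. fst (ev W u) (snd (ev W t)) = fst (ev W w) (snd (ev W t))" for t
    proof -
      have "\<forall>\<^sub>F W in ?F. fst (ev W u) (snd (ev W t)) = fst (ev W v) (snd (ev W t))"
        "\<forall>\<^sub>F W in ?F. fst (ev W v) (snd (ev W t)) = fst (ev W w) (snd (ev W t))"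
        using that by (auto simp: same_def)
      then show ?thesis
        by eventually_elim simp
    qed
    ultimately show ?thesis
      by (simp add: same_def)
  qed
  have same_exact: "same u v" if "\<And>W. finite W \<Longrightarrow> ev W u = ev W v" for u v
    unfolding same_def using that by (auto intro: eventually_mono[OF ev_finite])
  have same_append: "same (u @ v) (u' @ v')" if "same u u'" "same v v'" for u u' v v'
    unfolding same_def
  proof (intro conjI allI)
    have u: "\<forall>\<^sub>F W in ?F. snd (ev W u) = snd (ev W u')"
      and v: "\<forall>\<^sub>F W in ?F. snd (ev W v) = snd (ev W v')"
      using that by (auto simp: same_def)
    show "\<forall>\<^sub>F W in ?F. snd (ev W (u @ v)) = snd (ev W (u' @ v'))"
      using u v ev_finite
      by eventually_elim (simp add: ev_append P_def snd_mult_wreath)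
    fix t
    \<comment> \<open>In the product, the second factor is read at a point shifted by the component
      of \<open>u\<close>, which is the point produced by \<open>t @ u\<close>. Test points produced
      by words are closed under this shift.\<close>
    have ut: "\<forall>\<^sub>F W in ?F. fst (ev W u) (snd (ev W t)) = fst (ev W u') (snd (ev W t))"
      and vt: "\<forall>\<^sub>F W in ?F. fst (ev W v) (snd (ev W (t @ u))) = fst (ev W v') (snd (ev W (t @ u)))"
      using that unfolding same_def by blast+
    show "\<forall>\<^sub>F W in ?F. fst (ev W (u @ v)) (snd (ev W t)) = fst (ev W (u' @ v')) (snd (ev W t))"
      using u ut vt ev_finite
    proof eventually_elim
      case (elim W)
      then show ?case
        using snd_ev[of W t] by (simp add: ev_append P_def fst_mult_wreath snd_mult_wreath)
    qed
  qed
  obtain enc :: "((('g \<Rightarrow> 'h) \<times> 'g) alphabet \<times> bool) list \<Rightarrow> ('g \<Rightarrow> 'h) \<times> 'g" where enc: "inj enc"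
    using infinite_alphabet_encoding[OF inf] by blast
  \<comment> \<open>Coding by \<open>enc\<close> turns a class of words into a set of elements of
    the type of the wreath product, as \<open>solvable_over\<close> requires.\<close>
  define c where "c u = enc ` {v. same u v}" for u
  have c_eq: "c u = c v \<longleftrightarrow> same u v" for u v
  proof -
    have "{w. same u w} = {w. same v w} \<longleftrightarrow> same u v"
      using same_exact[of v v] same_sym same_trans by blast
    then show ?thesis
      by (simp add: c_def inj_image_eq_iff[OF enc])
  qed
  have inv_word: "c (inverse_word u @ u) = c []" for u
    unfolding c_eq
  proof (rule same_exact)
    fix W :: "((('g \<Rightarrow> 'h) \<times> 'g) alphabet \<times> bool) list set" assume W: "finite W"
    interpret group "P W"
      by (rule grp[OF W])
    show "ev W (inverse_word u @ u) = ev W []"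
      using word_value_inverse_word[of "e W" u] e_closed[OF W] ev_closed[OF W, of u]
      by (simp add: ev_append[OF W]) (simp add: ev_def)
  qed
  obtain L :: "(('g \<Rightarrow> 'h) \<times> 'g) set monoid" where L: "group L" "carrier L = range c" "\<one>\<^bsub>L\<^esub> = c []"
    and mult: "\<And>u v. c u \<otimes>\<^bsub>L\<^esub> c v = c (u @ v)"
    proof (rule quotient_of_words_group[of c])
    show "c (u @ v) = c (u' @ v')" if "c u = c u'" "c v = c v'" for u u' v v'
      using that same_append by (simp add: c_eq)
    show "\<exists>v. c (v @ u) = c []" for u
      using inv_word by blast
  qed (rule that)
  interpret L: group L by fact
  \<comment> \<open>Inverse letters must agree with inverses in \<open>L\<close>, so that evaluating
    a word in \<open>L\<close> yields its class.\<close>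
  have inv_gen: "inv\<^bsub>L\<^esub> (c (gen l)) = c [(l, True)]" for l
    using inv_word[of "gen l"] mult L(2,3)
    by (intro L.inv_equality) (auto simp: gen_def inverse_word_def)
  define \<phi> where "\<phi> u = c (gen (Inl u))" for u

  have hom: "\<phi> \<in> hom ?\<Gamma> L"
  proof (rule homI)
    fix u v assume u: "u \<in> carrier ?\<Gamma>" and v: "v \<in> carrier ?\<Gamma>"
    have "same (gen (Inl (u \<otimes>\<^bsub>?\<Gamma>\<^esub> v))) (gen (Inl u) @ gen (Inl v))"
      unfolding same_def
    proof (intro conjI allI)
      show "\<forall>\<^sub>F W in ?F. snd (ev W (gen (Inl (u \<otimes>\<^bsub>?\<Gamma>\<^esub> v)))) = snd (ev W (gen (Inl u) @ gen (Inl v)))"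
        using ev_finite
      proof eventually_elim
        case (elim W)
        then show ?case
          using approx[OF elim] u v
          by (simp add: finite_approximation_def ev_append ev_gen P_def snd_mult_wreath)
      qed
      fix t
      show "\<forall>\<^sub>F W in ?F. fst (ev W (gen (Inl (u \<otimes>\<^bsub>?\<Gamma>\<^esub> v)))) (snd (ev W t)) =
          fst (ev W (gen (Inl u) @ gen (Inl v))) (snd (ev W t))"
        \<comment> \<open>The one-letter word of \<open>u\<close> in \<open>W\<close> puts
          \<open>snd u\<close> into \<open>E W\<close>; having \<open>t\<close> in \<open>W\<close>
          gives multiplicativity at the point produced by \<open>t\<close>.\<close>
        using ev_finite ev_mem[of "gen (Inl u)"] ev_mem[of t]
      proof eventually_elim
        case (elim W)
        have "snd u \<in> E W"
          using elim u by (auto simp: E_def)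
        then show ?case
          using approx[OF elim(1)] u v elim
          by (simp add: finite_approximation_def Let_def ev_append ev_gen) (simp add: P_def ev_def)
      qed
    qed
    then show "\<phi> (u \<otimes>\<^bsub>?\<Gamma>\<^esub> v) = \<phi> u \<otimes>\<^bsub>L\<^esub> \<phi> v"
      by (simp add: \<phi>_def mult c_eq)
  qed (simp add: \<phi>_def L(2))

  have inj: "inj_on \<phi> (carrier ?\<Gamma>)"
  proof (rule inj_onI)
    fix u v assume u: "u \<in> carrier ?\<Gamma>" and v: "v \<in> carrier ?\<Gamma>" and "\<phi> u = \<phi> v"
    then have same: "same (gen (Inl u)) (gen (Inl v))"
      by (simp add: \<phi>_def c_eq)
    have "\<forall>\<^sub>F W in ?F. snd u = snd v"
      using conjunct1[OF same[unfolded same_def]] ev_finite ev_mem[of "gen (Inl u)"] ev_mem[of "gen (Inl v)"]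
    proof eventually_elim
      case (elim W)
      then have "snd u \<in> E W" "snd v \<in> E W"
        using u v by (auto simp: E_def)
      then show ?case
        using approx[OF elim(2)] elim u v by (simp add: finite_approximation_def ev_gen)
    qed
    \<comment> \<open>The filter is nontrivial, so a statement independent of \<open>W\<close> that
      holds eventually is true.\<close>
    then have "snd u = snd v"
      by (simp add: eventually_const)
    moreover have "fst u x = fst v x" if "x \<in> carrier G" for x
    proof -
      \<comment> \<open>The letter of an element with second component \<open>x\<close> produces the
        point of \<open>Q W\<close> standing for \<open>x\<close>, where \<open>same\<close>
        compares the two functions.\<close>
      define z where "z = (fst u, x)"
      have z: "z \<in> carrier ?\<Gamma>" "snd z = x"
        using u that by (auto simp: z_def carrier_wreath)
      have "\<forall>\<^sub>F W in ?F. fst u x = fst v x"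
        using spec[OF conjunct2[OF same[unfolded same_def]], of "gen (Inl z)"] ev_finite ev_mem[of "gen (Inl z)"]
      proof eventually_elim
        case (elim W)
        then have "x \<in> E W"
          using z by (auto simp: E_def)
        then show ?case
          using approx[OF elim(2)] elim u v z by (simp add: finite_approximation_def ev_gen)
      qed
      then show ?thesis
        by (simp add: eventually_const)
    qed
    then have "fst u = fst v"
      using u v by (intro extensionalityI[of _ "carrier G"]) (auto simp: carrier_wreath mem_Times_iff PiE_iff)
    ultimately show "u = v"
      by (simp add: prod_eq_iff)
  qed

  have "\<exists>x\<in>{..<n} \<rightarrow> carrier L. \<forall>w\<in>set ws. eval_word L (\<phi> \<circ> a) x w = \<one>\<^bsub>L\<^esub>"
    if a: "a \<in> {..<k} \<rightarrow> carrier ?\<Gamma>" for a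
  proof (intro bexI ballI)
    define b where "b = map a [0..<k]"
    have b: "constant_tuple ?\<Gamma> k b"
      using a by (auto simp: b_def constant_tuple_def)
    define \<sigma> where "\<sigma> = case_sum (\<lambda>i. Inl (b ! i)) (\<lambda>j :: nat. Inr (b, j))"
    define x where "x j = c (gen (Inr (b, j)))" for j
    show "x \<in> {..<n} \<rightarrow> carrier L"
      by (auto simp: x_def L(2))
    fix w assume w: "w \<in> set ws"
    have "eval_word L (\<phi> \<circ> a) x w = word_value L (\<lambda>l. c (gen (\<sigma> l))) w"
      unfolding eval_word_eq_word_value
    proof (rule word_value_cong)
      fix l assume l: "l \<in> set w"
      show "case_sum (\<phi> \<circ> a) x (fst l) = c (gen (\<sigma> (fst l)))"
        by (rule wf_system_letter[OF wf w l]) (simp_all add: \<phi>_def x_def \<sigma>_def b_def)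
    qed
    also have "\<dots> = c (map (map_prod \<sigma> id) w)"
    proof (induction w)
      case (Cons l w)
      then show ?case
        by (cases l) (simp add: gen_def inv_gen[unfolded gen_def] mult)
    qed (simp add: L(3))
    also have "\<dots> = c []"
      unfolding c_eq
    proof (rule same_exact)
      fix W :: "((('g \<Rightarrow> 'h) \<times> 'g) alphabet \<times> bool) list set" assume W: "finite W"
      have "ev W (map (map_prod \<sigma> id) w) = instance_value (P W) (e W) b w"
        unfolding ev_def word_value_map instance_value_def \<sigma>_def
        by (rule word_value_cong) (simp split: sum.split)
      then show "ev W (map (map_prod \<sigma> id) w) = ev W []"
        using approx[OF W] b w by (simp add: finite_approximation_def ev_def P_def)
    qed
    finally show "eval_word L (\<phi> \<circ> a) x w = \<one>\<^bsub>L\<^esub>"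
      by (simp add: L(3))
  qed
  then show ?thesis
    unfolding solvable_over_def using L(1) hom inj by blast
qed

theorem theorem2:
  fixes H :: "'h monoid" and G :: "'g monoid"
    and k n :: nat and ws :: "word list"
  assumes "group H" and "finite (carrier H)"
    and "group G" and "finitely_generated G" and "residually_finite G"
    and "SysFin k n ws"
  shows "solvable_over (wreath H G) k n ws"
proof (cases "finite (UNIV :: (('g \<Rightarrow> 'h) \<times> 'g) set)")
  \<comment> \<open>A finite type has no room for the coding of words, but then the wreath product
    is finite and the system is solvable in it already.\<close>
  case True
  have "group (wreath H G)"
    by (rule wreath_group) fact+
  moreover have "finite (carrier (wreath H G))"
    using True by (rule rev_finite_subset) simp
  ultimately show ?thesis
    using assms(6) SysFin_finite_group[OF assms(6)]
    by (intro solvable_in_imp_solvable_over) (simp_all add: SysFin_def)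
next
  case False
  then show ?thesis
    using assms by (intro wreath_solvable_over_infinite) simp_all
qed

end
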